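(* Let $E/\mathbb{Q}$ be an elliptic curve with good reduction outside a finite set $S$ of primes, for $p\notin S$ let $a_p=p+1-\#E(\mathbb{F}_p)$, and let $L_p(E,s)=(1-a_pp^{-s}+p^{1-2s})^{-1}$ be its local $L$-factor. There exists no entire function $f:\mathbb{C}\to\mathbb{C}$ such that $f(p^{-s})=L_p(E,s)^{-1}$ for all $p\notin S$ and all $s\in\mathbb{C}$. *)

theory Defs
  imports
    "HOL-Number_Theory.Number_Theory"
    "HOL-Complex_Analysis.Complex_Analysis"
begin

text \<open>The coefficients of a Weierstrass equation
  \<open>y\<^sup>2 + a\<^sub>1 x y + a\<^sub>3 y = x\<^sup>3 + a\<^sub>2 x\<^sup>2 + a\<^sub>4 x + a\<^sub>6\<close>.\<close>

datatype 'a weierstrass =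
  Weierstrass (wa1: 'a) (wa2: 'a) (wa3: 'a) (wa4: 'a) (wa6: 'a)

definition discriminant :: "'a::comm_ring_1 weierstrass \<Rightarrow> 'a" where
  "discriminant W =
    (let b2 = wa1 W ^ 2 + 4 * wa2 W;
         b4 = 2 * wa4 W + wa1 W * wa3 W;
         b6 = wa3 W ^ 2 + 4 * wa6 W;
         b8 = wa1 W ^ 2 * wa6 W + 4 * wa2 W * wa6 W - wa1 W * wa3 W * wa4 W
              + wa2 W * wa3 W ^ 2 - wa4 W ^ 2
     in - (b2 ^ 2 * b8) - 8 * b4 ^ 3 - 27 * b6 ^ 2 + 9 * b2 * b4 * b6)"

definition elliptic_curve :: "'a::field weierstrass \<Rightarrow> bool" where
  "elliptic_curve W \<longleftrightarrow> discriminant W \<noteq> 0"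

text \<open>The coefficients after the substitution
  \<open>x = u\<^sup>2 x' + r\<close>, \<open>y = u\<^sup>3 y' + u\<^sup>2 s x' + t\<close>.\<close>

definition change_vars ::
  "'a::field \<Rightarrow> 'a \<Rightarrow> 'a \<Rightarrow> 'a \<Rightarrow> 'a weierstrass \<Rightarrow> 'a weierstrass" where
  "change_vars u r s t W = Weierstrass
     ((wa1 W + 2 * s) / u)
     ((wa2 W - s * wa1 W + 3 * r - s ^ 2) / u ^ 2)
     ((wa3 W + r * wa1 W + 2 * t) / u ^ 3)
     ((wa4 W - s * wa3 W + 2 * r * wa2 W - (t + r * s) * wa1 W + 3 * r ^ 2 - 2 * s * t) / u ^ 4)
     ((wa6 W + r * wa4 W + r ^ 2 * wa2 W + r ^ 3 - t * wa3 W - t ^ 2 - r * t * wa1 W) / u ^ 6)"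

definition model_of :: "'a::field weierstrass \<Rightarrow> 'a weierstrass \<Rightarrow> bool" where
  "model_of E W \<longleftrightarrow> (\<exists>u r s t. u \<noteq> 0 \<and> W = change_vars u r s t E)"

definition p_integral :: "nat \<Rightarrow> rat \<Rightarrow> bool" where
  "p_integral p x \<longleftrightarrow> \<not> int p dvd snd (quotient_of x)"

definition padic_val :: "nat \<Rightarrow> rat \<Rightarrow> int" where
  "padic_val p x = int (multiplicity (int p) (fst (quotient_of x)))
                 - int (multiplicity (int p) (snd (quotient_of x)))"

text \<open>Elements of \<open>\<int>/p\<close> are represented by integers in \<open>{0..<p}\<close>.\<close>

definition red_mod :: "nat \<Rightarrow> rat \<Rightarrow> int" where
  "red_mod p x =
     (fst (quotient_of x) * modular_inverse (int p) (snd (quotient_of x))) mod int p"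

definition integral_model :: "nat \<Rightarrow> rat weierstrass \<Rightarrow> rat weierstrass \<Rightarrow> bool" where
  "integral_model p E W \<longleftrightarrow> model_of E W \<and> (\<forall>a\<in>set_weierstrass W. p_integral p a)"

definition is_minimal_model :: "nat \<Rightarrow> rat weierstrass \<Rightarrow> rat weierstrass \<Rightarrow> bool" where
  "is_minimal_model p E W \<longleftrightarrow> integral_model p E W \<and>
     (\<forall>W'. integral_model p E W' \<longrightarrow>
        padic_val p (discriminant W) \<le> padic_val p (discriminant W'))"

text \<open>A minimal model at \<open>p\<close> exists (shown below) and is unique up to a change of variables
  with \<open>u\<close> a \<open>p\<close>-adic unit and \<open>r, s, t\<close> \<open>p\<close>-integral (Silverman, The Arithmetic of Elliptic
  Curves, VII.1.3), so neither good reduction nor the number of points of the reduction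
  depends on the choice.\<close>

definition minimal_model :: "nat \<Rightarrow> rat weierstrass \<Rightarrow> rat weierstrass" where
  "minimal_model p E = (SOME W. is_minimal_model p E W)"

definition reduction :: "nat \<Rightarrow> rat weierstrass \<Rightarrow> int weierstrass" where
  "reduction p E = map_weierstrass (red_mod p) (minimal_model p E)"

definition good_reduction :: "nat \<Rightarrow> rat weierstrass \<Rightarrow> bool" where
  "good_reduction p E \<longleftrightarrow> \<not> [discriminant (reduction p E) = 0] (mod int p)"

text \<open>\<open>None\<close> is the point at infinity.\<close>

definition points_mod :: "nat \<Rightarrow> int weierstrass \<Rightarrow> (int \<times> int) option set" where
  "points_mod p W = insert None (Some ` {(x, y). x \<in> {0..<int p} \<and> y \<in> {0..<int p} \<and>
     [y ^ 2 + wa1 W * x * y + wa3 W * y = x ^ 3 + wa2 W * x ^ 2 + wa4 W * x + wa6 W] (mod int p)})"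

definition trace_frob :: "rat weierstrass \<Rightarrow> nat \<Rightarrow> int" where
  "trace_frob E p = int p + 1 - int (card (points_mod p (reduction p E)))"

definition local_L :: "rat weierstrass \<Rightarrow> nat \<Rightarrow> complex \<Rightarrow> complex" where
  "local_L E p s = inverse (1 - of_int (trace_frob E p) * of_nat p powr (- s)
                              + of_nat p powr (1 - 2 * s))"

lemma p_integral_iff:
  assumes "prime p"
  shows "p_integral p x \<longleftrightarrow> (\<exists>a b. x = of_int a / of_int b \<and> \<not> int p dvd b)"
proof
  assume "p_integral p x"
  moreover obtain a b where "quotient_of x = (a, b)" by (cases "quotient_of x")
  ultimately show "\<exists>a b. x = of_int a / of_int b \<and> \<not> int p dvd b"
    using quotient_of_div[of x a b] by (auto simp: p_integral_def)
next
  assume "\<exists>a b. x = of_int a / of_int b \<and> \<not> int p dvd b"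
  then obtain a b where ab: "x = of_int a / of_int b" "\<not> int p dvd b" by blast
  obtain c d where cd: "quotient_of x = (c, d)" by (cases "quotient_of x")
  have d: "d > 0" "coprime c d" "x = of_int c / of_int d"
    using cd quotient_of_denom_pos quotient_of_coprime quotient_of_div by blast+
  have "b \<noteq> 0" using ab by auto
  hence "of_int (a * d) = (of_int (c * b) :: rat)"
    using d ab by (simp add: field_simps)
  hence "a * d = c * b" by (simp only: of_int_eq_iff)
  hence "d dvd b" using d(2) by (metis coprime_commute coprime_dvd_mult_right_iff dvd_triv_right)
  thus "p_integral p x" using ab cd by (auto simp: p_integral_def dest: dvd_trans)
qed

lemma p_integral_of_int:
  assumes "prime p" shows "p_integral p (of_int a)"
  unfolding p_integral_iff[OF assms]
  by (rule exI[of _ a], rule exI[of _ 1]) (use assms prime_gt_1_nat[OF assms] in auto)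

lemma p_integral_ring:
  assumes "prime p" "p_integral p x" "p_integral p y"
  shows "p_integral p (x + y)" "p_integral p (x - y)" "p_integral p (x * y)"
proof -
  obtain a b c d where ab: "x = of_int a / of_int b" "\<not> int p dvd b"
    and cd: "y = of_int c / of_int d" "\<not> int p dvd d"
    using assms by (auto simp: p_integral_iff)
  have nz: "b \<noteq> 0" "d \<noteq> 0" using ab cd by auto
  have bd: "\<not> int p dvd b * d" using ab cd assms(1) by (simp add: prime_dvd_mult_iff)
  have "x + y = of_int (a * d + c * b) / of_int (b * d)"
       "x - y = of_int (a * d - c * b) / of_int (b * d)"
       "x * y = of_int (a * c) / of_int (b * d)"
    unfolding ab(1) cd(1) using nz by (simp_all add: add_divide_distrib diff_divide_distrib)
  thus "p_integral p (x + y)" "p_integral p (x - y)" "p_integral p (x * y)"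
    unfolding p_integral_iff[OF assms(1)] using bd by blast+
qed

lemma p_integral_power:
  assumes "prime p" "p_integral p x" shows "p_integral p (x ^ n)"
  by (induction n) (use assms p_integral_of_int[of p 1] in \<open>auto intro: p_integral_ring\<close>)

lemma p_integral_numeral: "prime p \<Longrightarrow> p_integral p (numeral k)"
  using p_integral_of_int[of p "numeral k"] by simp

lemma p_integral_uminus: "prime p \<Longrightarrow> p_integral p x \<Longrightarrow> p_integral p (- x)"
  using p_integral_ring(2)[of p 0 x] p_integral_of_int[of p 0] by simp

lemma padic_val_nonneg: "p_integral p x \<Longrightarrow> padic_val p x \<ge> 0"
  by (simp add: p_integral_def padic_val_def not_dvd_imp_multiplicity_0)

lemma integral_model_exists:
  assumes "prime p"
  shows "\<exists>W. integral_model p E W"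
proof -
  define den where "den x = snd (quotient_of x)" for x :: rat
  define N where "N = den (wa1 E) * den (wa2 E) * den (wa3 E) * den (wa4 E) * den (wa6 E)"
  have pos: "den x > 0" for x by (simp add: den_def quotient_of_denom_pos')
  have N: "N > 0" by (simp add: N_def pos)
  have clear: "p_integral p (x * of_int N ^ k)" if "den x dvd N" "k > 0" for x k
  proof -
    obtain c where c: "N = den x * c" using \<open>den x dvd N\<close> by (rule dvdE)
    have "x = of_int (fst (quotient_of x)) / of_int (den x)"
      unfolding den_def by (metis prod.collapse quotient_of_div)
    hence "x * of_int N = of_int (fst (quotient_of x) * c)"
      using pos[of x] c by (simp add: field_simps)
    moreover have "x * of_int N ^ k = (x * of_int N) * of_int (N ^ (k - 1))"
      using \<open>k > 0\<close> by (cases k) (auto simp: algebra_simps)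
    ultimately have "x * of_int N ^ k = of_int (fst (quotient_of x) * c * N ^ (k - 1))"
      by (simp only: of_int_mult)
    thus ?thesis using p_integral_of_int[OF assms] by metis
  qed
  have "integral_model p E (change_vars (1 / of_int N) 0 0 0 E)"
    unfolding integral_model_def model_of_def
  proof (intro conjI exI ballI)
    show "1 / of_int N \<noteq> (0 :: rat)" using N by simp
    fix a assume "a \<in> set_weierstrass (change_vars (1 / of_int N) 0 0 0 E)"
    moreover have "den (wa1 E) dvd N" "den (wa2 E) dvd N" "den (wa3 E) dvd N"
      "den (wa4 E) dvd N" "den (wa6 E) dvd N" by (simp_all add: N_def)
    note clear[OF this(1), of 1] clear[OF this(2), of 2] clear[OF this(3), of 3]
      clear[OF this(4), of 4] clear[OF this(5), of 6]
    ultimately show "p_integral p a"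
      by (auto simp: change_vars_def power_divide)
  qed (rule refl)
  thus ?thesis by blast
qed

lemma minimal_model_exists:
  assumes "prime p"
  shows "\<exists>W. is_minimal_model p E W"
proof -
  let ?v = "\<lambda>W. padic_val p (discriminant W)"
  obtain W0 where "integral_model p E W0" using integral_model_exists[OF assms] by blast
  then obtain W where W: "integral_model p E W"
    "\<And>W'. integral_model p E W' \<Longrightarrow> nat (?v W) \<le> nat (?v W')"
    using ex_has_least_nat[of "integral_model p E" W0 "\<lambda>W. nat (?v W)"] by blast
  have "?v W' \<ge> 0" if "integral_model p E W'" for W'
  proof (rule padic_val_nonneg)
    have "p_integral p (wa1 W')" "p_integral p (wa2 W')" "p_integral p (wa3 W')"
      "p_integral p (wa4 W')" "p_integral p (wa6 W')"
      using that by (cases W'; simp add: integral_model_def)+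
    thus "p_integral p (discriminant W')"
      unfolding discriminant_def Let_def
      by (intro p_integral_ring p_integral_power p_integral_numeral p_integral_uminus assms)
  qed
  hence "is_minimal_model p E W"
    using W by (force simp: is_minimal_model_def)
  thus ?thesis by blast
qed

end

theory Submission
  imports Defs
begin

text \<open>For fixed \<open>p\<close> the values \<open>p\<^sup>-\<^sup>s\<close> exhaust the nonzero complex numbers, so \<open>f\<close> would agree
  with \<open>1 - a\<^sub>p z + p z\<^sup>2\<close> at every nonzero \<open>z\<close>. Then \<open>f 1 + f (- 1) = 2 + 2 p\<close>, which cannot hold
  for two different primes.\<close>

text \<open>Since \<open>p powr (1 - 2 * s)\<close> is \<open>p\<close> times the square of
  \<open>p powr (- s)\<close>, the reciprocal of the local factor is a quadratic polynomial in
  \<open>p powr (- s)\<close>.\<close>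

lemma inverse_local_L:
  "inverse (local_L E p s) =
     1 - of_int (trace_frob E p) * of_nat p powr (- s) + of_nat p * (of_nat p powr (- s)) ^ 2"
proof -
  have "(of_nat p :: complex) powr (1 - 2 * s) = of_nat p powr (1 + (- s + - s))"
    by simp
  also have "\<dots> = of_nat p * (of_nat p powr (- s)) ^ 2"
    by (simp only: powr_add) (simp add: power2_eq_square)
  finally show ?thesis
    by (simp add: local_L_def)
qed

text \<open>Solved by a logarithm: \<open>p > 1\<close> makes \<open>Ln p\<close> nonzero, so
  \<open>s = - Ln z / Ln p\<close> works.\<close>

lemma of_nat_powr_surj_nonzero:
  fixes z :: complex
  assumes "p > 1" "z \<noteq> 0"
  obtains s where "(of_nat p :: complex) powr (- s) = z"
proof
  have "Ln (of_nat p) \<noteq> (0 :: complex)"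
    using assms(1) by simp
  thus "(of_nat p :: complex) powr (- (- Ln z / Ln (of_nat p))) = z"
    using assms by (simp add: powr_def)
qed

theorem mainTheorem16:
  fixes E :: "rat weierstrass" and S :: "nat set"
  assumes "elliptic_curve E"
    and "finite S" and "\<forall>p\<in>S. prime p"
    and "\<forall>p. prime p \<and> p \<notin> S \<longrightarrow> good_reduction p E"
  shows "\<not> (\<exists>f :: complex \<Rightarrow> complex. f holomorphic_on UNIV \<and>
           (\<forall>p. prime p \<and> p \<notin> S \<longrightarrow>
              (\<forall>s. f (of_nat p powr (- s)) = inverse (local_L E p s))))"
proof
  assume "\<exists>f :: complex \<Rightarrow> complex. f holomorphic_on UNIV \<and>
           (\<forall>p. prime p \<and> p \<notin> S \<longrightarrow>
              (\<forall>s. f (of_nat p powr (- s)) = inverse (local_L E p s)))"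
  then obtain f :: "complex \<Rightarrow> complex" where
    f: "\<And>p s. prime p \<Longrightarrow> p \<notin> S \<Longrightarrow> f (of_nat p powr (- s)) = inverse (local_L E p s)"
    by blast
  have f_eq: "f z = 1 - of_int (trace_frob E p) * z + of_nat p * z ^ 2"
    if pz: "prime p" "p \<notin> S" "z \<noteq> 0" for p z
  proof -
    obtain s where "(of_nat p :: complex) powr (- s) = z"
      using of_nat_powr_surj_nonzero[OF prime_gt_1_nat[OF pz(1)] pz(3)] .
    thus ?thesis
      using f[OF pz(1,2), of s] inverse_local_L[of E p s] by simp
  qed
  \<comment> \<open>The linear terms at \<open>1\<close> and \<open>- 1\<close> cancel, which
    removes the unknown trace and leaves a value that determines \<open>p\<close>.\<close>
  have f_sum: "f 1 + f (- 1) = 2 + 2 * of_nat p" if "prime p" "p \<notin> S" for p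
    using f_eq[OF that, of 1] f_eq[OF that, of "- 1"] by simp
  have inf: "infinite ({p :: nat. prime p} - S)"
    using primes_infinite assms(2) by simp
  obtain p where p: "prime p" "p \<notin> S"
    using infinite_imp_nonempty[OF inf] by auto
  \<comment> \<open>Deleting \<open>p\<close> from an infinite set leaves it infinite, hence
    nonempty.\<close>
  obtain q where q: "prime q" "q \<notin> S" "q \<noteq> p"
    using infinite_imp_nonempty[OF infinite_remove[OF inf, of p]] by auto
  have "(of_nat p :: complex) = of_nat q"
    using f_sum[OF p] f_sum[OF q(1,2)] by simp
  thus False
    using q(3) by simp
qed

end
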